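(* For a $k$-element subset $M\subset J$, let $\mathrm{Jac}_M$ be the Jacobian (determinant) of the projection $\Lambda\to\mathbb C^n-\Delta$, $(z,p)\mapsto z$, with respect to the ordered coordinate system $z_M,p_{\bar M}$ on $\Lambda$ and the ordered coordinate system $z_1,\dots,z_n$ on $\mathbb C^n-\Delta$. Then, as functions on $\Lambda$, $$d_M^2\,\mathrm{Jac}_M=(-1)^n\,\mathrm{Hess}\,\Phi\,\prod_{j\in J}\frac{a_j}{p_j^2}.$$
   Context: Let $n>k$ be positive integers, $J=\{1,\dots,n\}$. Let $t_1,\dots,t_k$ be coordinates on $\mathbb C^k$ and $z_1,\dots,z_n$ coordinates on $\mathbb C^n$. Fix linear functions $g_j=\sum_{m=1}^k b_j^m t_m$, $j\in J$, with $b_j^m\in\mathbb C$, and put $d_{i_1,\dots,i_k}=\det_{\ell,m=1}^k(b^m_{i_\ell})$. Assume $d_{i_1,\dots,i_k}\neq0$ whenever $i_1,\dots,i_k\in J$ are distinct. For a $k$-element subset $I=\{i_1,\dots,i_k\}\subset J$ put $d_I^2=(d_{i_1,\dots,i_k})^2$, and $\bar I=J\setminus I$. Put $f_j(z,t)=z_j+g_j(t)$ on $\mathbb C^n\times\mathbb C^k$. For distinct $i_1,\dots,i_{k+1}\in J$ put $$f_{i_1,\dots,i_{k+1}}(z)=\sum_{m=1}^{k+1}(-1)^{m-1}d_{i_1,\dots,\widehat{i_m},\dots,i_{k+1}}z_{i_m},$$ and let $\Delta\subset\mathbb C^n$ be the union over all $(k+1)$-element subsets $\{i_1<\dots<i_{k+1}\}\subset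 J$ of the hyperplanes $f_{i_1,\dots,i_{k+1}}(z)=0$. Fix nonzero weights $a_j\in\mathbb C^\times$, $j\in J$, with $|a|=\sum_{j\in J}a_j\neq0$. The master function is $\Phi(z,t)=\sum_{j\in J}a_j\log f_j(z,t)$. Let $U^0=\{(z,t)\in\mathbb C^n\times\mathbb C^k : z\notin\Delta,\ f_j(z,t)\ne0\ \text{for all } j\in J\}$ and $C_\Phi=\{(z,t)\in U^0: \partial\Phi/\partial t_i(z,t)=0,\ i=1,\dots,k\}$. Consider the map $\phi:C_\Phi\to(\mathbb C^n-\Delta)\times(\mathbb C^\times)^n$, $(z,t)\mapsto(z_1,\dots,z_n,p_1,\dots,p_n)$ with $p_j=\frac{\partial\Phi}{\partial z_j}(z,t)=a_j/f_j(z,t)$, and put $\Lambda=\phi(C_\Phi)$, a smooth $n$-dimensional variety; $\phi:C_\Phi\to\Lambda$ is a bijection. The Hessian $\mathrm{Hess}\,\Phi=\det_{i,j=1}^k\big(\frac{\partial^2\Phi}{\partial t_i\partial t_j}\big)$, a function on $C_\Phi$, is regarded as a function on $\Lambda$ via $\phi$. For any $k$-element subset $M\subset J$, the functions $z_M=\{z_i: i\in M\}$, $p_{\bar M}=\{p_j: j\in\bar M\}$ form a system of coordinates on $\Lambda$; these functions are ordered by increasing index (e.g. for $k=3$, $n=6$, $M=\{1,3,6\}$ the order is $z_1,p_2,z_3,p_4,p_5,z_6$). *)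

theory Defs
  imports "HOL-Analysis.Analysis" "Jordan_Normal_Form.Determinant"
begin

(* HOL-Analysis and Jordan_Normal_Form both use $, vec and det; here they always mean the
   Jordan_Normal_Form versions. *)
unbundle no vec_syntax
hide_const (open) Determinants.det
hide_const (open) Finite_Cartesian_Product.vec

text \<open>
  Indices are shifted by one: \<open>J = {..<n}\<close>, the coordinates of \<open>\<complex>\<^sup>k\<close> are indexed by \<open>{..<k}\<close>,
  and \<open>b j m\<close> is the coefficient of \<open>t\<^sub>m\<close> in \<open>g\<^sub>j\<close>.  Points of \<open>\<complex>\<^sup>n\<close> are the elements of
  \<open>carrier_vec n\<close>.
\<close>

definition lin_form :: "nat \<Rightarrow> (nat \<Rightarrow> nat \<Rightarrow> complex) \<Rightarrow> nat \<Rightarrow> complex vec \<Rightarrow> complex" where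
  "lin_form k b j t = (\<Sum>m<k. b j m * t $ m)"

definition f_fun :: "nat \<Rightarrow> (nat \<Rightarrow> nat \<Rightarrow> complex) \<Rightarrow> nat \<Rightarrow> complex vec \<Rightarrow> complex vec \<Rightarrow> complex" where
  "f_fun k b j z t = z $ j + lin_form k b j t"

definition minor :: "nat \<Rightarrow> (nat \<Rightarrow> nat \<Rightarrow> complex) \<Rightarrow> nat list \<Rightarrow> complex" where
  "minor k b idx = det (mat k k (\<lambda>(l, m). b (idx ! l) m))"

(* The square does not depend on the order in which the elements of I are listed. *)
definition minor_sq :: "nat \<Rightarrow> (nat \<Rightarrow> nat \<Rightarrow> complex) \<Rightarrow> nat set \<Rightarrow> complex" where
  "minor_sq k b I = (minor k b (sorted_list_of_set I))\<^sup>2"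

(* The list idx has k + 1 entries; its m-th entry is omitted in the minor.  With m counted
   from 0 the sign is (-1)^m. *)
definition f_tuple :: "nat \<Rightarrow> (nat \<Rightarrow> nat \<Rightarrow> complex) \<Rightarrow> nat list \<Rightarrow> complex vec \<Rightarrow> complex" where
  "f_tuple k b idx z =
     (\<Sum>m<k+1. (-1) ^ m * minor k b (take m idx @ drop (Suc m) idx) * z $ (idx ! m))"

definition discriminant :: "nat \<Rightarrow> nat \<Rightarrow> (nat \<Rightarrow> nat \<Rightarrow> complex) \<Rightarrow> complex vec set" where
  "discriminant n k b =
     {z \<in> carrier_vec n. \<exists>idx. length idx = k + 1 \<and> sorted_wrt (<) idx \<and> set idx \<subseteq> {..<n} \<and>
        f_tuple k b idx z = 0}"

definition U0 :: "nat \<Rightarrow> nat \<Rightarrow> (nat \<Rightarrow> nat \<Rightarrow> complex) \<Rightarrow> (complex vec \<times> complex vec) set" where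
  "U0 n k b =
     {(z, t). z \<in> carrier_vec n - discriminant n k b \<and> t \<in> carrier_vec k \<and>
        (\<forall>j<n. f_fun k b j z t \<noteq> 0)}"

definition partial :: "nat \<Rightarrow> (complex vec \<Rightarrow> complex) \<Rightarrow> complex vec \<Rightarrow> complex" where
  "partial i F v = deriv (\<lambda>s. F (v + s \<cdot>\<^sub>v unit_vec (dim_vec v) i)) 0"

text \<open>
  The master function is multivalued.  \<open>log_branch w\<^sub>0\<close> is the branch of the logarithm that is
  holomorphic on the plane slit along the ray from \<open>0\<close> through \<open>-w\<^sub>0\<close> and takes the value \<open>Ln w\<^sub>0\<close>
  at \<open>w\<^sub>0\<close>, and \<open>master n k b a z\<^sub>0 t\<^sub>0\<close> is the resulting branch of \<open>\<Phi>\<close> near \<open>(z\<^sub>0, t\<^sub>0)\<close>.  Any two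
  branches near \<open>(z\<^sub>0, t\<^sub>0)\<close> differ by a constant, so the partial derivatives of \<open>\<Phi>\<close> at a point are
  those of the branch based at that point.
\<close>

definition log_branch :: "complex \<Rightarrow> complex \<Rightarrow> complex" where
  "log_branch w0 w = Ln w0 + Ln (w / w0)"

definition master ::
  "nat \<Rightarrow> nat \<Rightarrow> (nat \<Rightarrow> nat \<Rightarrow> complex) \<Rightarrow> (nat \<Rightarrow> complex) \<Rightarrow> complex vec \<Rightarrow> complex vec \<Rightarrow>
   complex vec \<Rightarrow> complex vec \<Rightarrow> complex" where
  "master n k b a z0 t0 z t = (\<Sum>j<n. a j * log_branch (f_fun k b j z0 t0) (f_fun k b j z t))"

definition critical_set ::
  "nat \<Rightarrow> nat \<Rightarrow> (nat \<Rightarrow> nat \<Rightarrow> complex) \<Rightarrow> (nat \<Rightarrow> complex) \<Rightarrow> (complex vec \<times> complex vec) set" where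
  "critical_set n k b a =
     {(z, t) \<in> U0 n k b. \<forall>i<k. partial i (\<lambda>t'. master n k b a z t z t') t = 0}"

definition phi_map ::
  "nat \<Rightarrow> nat \<Rightarrow> (nat \<Rightarrow> nat \<Rightarrow> complex) \<Rightarrow> (nat \<Rightarrow> complex) \<Rightarrow> complex vec \<times> complex vec \<Rightarrow>
   complex vec \<times> complex vec" where
  "phi_map n k b a = (\<lambda>(z, t). (z, vec n (\<lambda>j. partial j (\<lambda>z'. master n k b a z t z' t) z)))"

definition Lam ::
  "nat \<Rightarrow> nat \<Rightarrow> (nat \<Rightarrow> nat \<Rightarrow> complex) \<Rightarrow> (nat \<Rightarrow> complex) \<Rightarrow> (complex vec \<times> complex vec) set" where
  "Lam n k b a = phi_map n k b a ` critical_set n k b a"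

definition Hess ::
  "nat \<Rightarrow> nat \<Rightarrow> (nat \<Rightarrow> nat \<Rightarrow> complex) \<Rightarrow> (nat \<Rightarrow> complex) \<Rightarrow> complex vec \<times> complex vec \<Rightarrow> complex" where
  "Hess n k b a = (\<lambda>(z, t). det (mat k k (\<lambda>(i, j).
     partial i (partial j (\<lambda>t'. master n k b a z t z t')) t)))"

definition Hess_Lam ::
  "nat \<Rightarrow> nat \<Rightarrow> (nat \<Rightarrow> nat \<Rightarrow> complex) \<Rightarrow> (nat \<Rightarrow> complex) \<Rightarrow> complex vec \<times> complex vec \<Rightarrow> complex" where
  "Hess_Lam n k b a q = Hess n k b a (the_inv_into (critical_set n k b a) (phi_map n k b a) q)"

(* The functions z_i (i in M) and p_j (j not in M), ordered by increasing index. *)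
definition chart :: "nat \<Rightarrow> nat set \<Rightarrow> complex vec \<times> complex vec \<Rightarrow> complex vec" where
  "chart n M = (\<lambda>(z, p). vec n (\<lambda>j. if j \<in> M then z $ j else p $ j))"

(* On the image of the chart, which is open, the projection to z becomes the map
   x |-> fst (the_inv_into (Lam n k b a) (chart n M) x). *)
definition Jac ::
  "nat \<Rightarrow> nat \<Rightarrow> (nat \<Rightarrow> nat \<Rightarrow> complex) \<Rightarrow> (nat \<Rightarrow> complex) \<Rightarrow> nat set \<Rightarrow>
   complex vec \<times> complex vec \<Rightarrow> complex" where
  "Jac n k b a M q = det (mat n n (\<lambda>(i, j).
     partial j (\<lambda>x. fst (the_inv_into (Lam n k b a) (chart n M) x) $ i) (chart n M q)))"

lemma exp_log_branch:
  assumes "w0 \<noteq> 0" "w \<noteq> 0"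
  shows "exp (log_branch w0 w) = w"
  using assms by (simp add: log_branch_def exp_add)

lemma log_branch_has_derivative:
  assumes "w0 \<noteq> 0" "w / w0 \<notin> \<real>\<^sub>\<le>\<^sub>0"
  shows "(log_branch w0 has_field_derivative 1 / w) (at w)"
  unfolding log_branch_def using assms
  by (auto intro!: derivative_eq_intros simp: field_simps)

lemma partial_z_master:
  assumes "z \<in> carrier_vec n" "j < n" "\<And>i. i < n \<Longrightarrow> f_fun k b i z t \<noteq> 0"
  shows "partial j (\<lambda>z'. master n k b a z t z' t) z = a j / f_fun k b j z t"
proof -
  have f: "f_fun k b i (z + s \<cdot>\<^sub>v unit_vec (dim_vec z) j) t
      = f_fun k b i z t + (if i = j then s else 0)" if "i < n" for i s
    using assms(1,2) that by (auto simp: f_fun_def unit_vec_def)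
  have d: "((\<lambda>s. a i * log_branch (f_fun k b i z t) (f_fun k b i z t + (if i = j then s else 0)))
      has_field_derivative (if i = j then a j / f_fun k b j z t else 0)) (at 0)" if "i < n" for i
  proof (cases "i = j")
    case True
    have nz: "f_fun k b j z t \<noteq> 0" using assms by blast
    have "((\<lambda>s. log_branch (f_fun k b j z t) (f_fun k b j z t + s)) has_field_derivative
        1 / f_fun k b j z t) (at 0)"
      using log_branch_has_derivative[of "f_fun k b j z t" "f_fun k b j z t"] nz
        DERIV_shift[of "log_branch (f_fun k b j z t)" "1 / f_fun k b j z t" 0 "f_fun k b j z t"]
      by (simp add: add.commute)
    from DERIV_cmult[OF this, of "a j"] True show ?thesis by simp
  qed simp
  have "((\<lambda>s. \<Sum>i<n. a i * log_branch (f_fun k b i z t)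
            (f_fun k b i z t + (if i = j then s else 0)))
      has_field_derivative (\<Sum>i<n. if i = j then a j / f_fun k b j z t else 0)) (at 0)"
    by (rule DERIV_sum) (use d in auto)
  moreover have "(\<Sum>i<n. if i = j then a j / f_fun k b j z t else 0) = a j / f_fun k b j z t"
    using assms(2) by simp
  moreover have "(\<lambda>s. master n k b a z t (z + s \<cdot>\<^sub>v unit_vec (dim_vec z) j) t) =
      (\<lambda>s. \<Sum>i<n. a i * log_branch (f_fun k b i z t)
            (f_fun k b i z t + (if i = j then s else 0)))"
    unfolding master_def by (intro ext sum.cong) (auto simp: f)
  ultimately show ?thesis
    unfolding partial_def by (metis DERIV_imp_deriv)
qed

end

theory Submission
  imports Defs
begin

text \<open>
  Let \<open>B\<close> be the \<open>n \<times> k\<close> matrix of the coefficients \<open>b j m\<close>.  A point of \<open>\<Lambda>\<close> together with its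
  critical point \<open>t\<close> is given by the equations \<open>z\<^sub>j = a\<^sub>j / p\<^sub>j - g\<^sub>j(t)\<close> and \<open>B\<^sup>T p = 0\<close>, up to the
  open conditions \<open>p\<^sub>j \<noteq> 0\<close> and \<open>z \<notin> \<Delta>\<close> (\<open>Lam_iff\<close>).  Put \<open>D = diag (p\<^sub>j\<^sup>2 / a\<^sub>j)\<close>; as
  \<open>p\<^sub>j = a\<^sub>j / f\<^sub>j\<close>, the Hessian is \<open>det (- B\<^sup>T D B)\<close> (\<open>Hess_Lam_eq\<close>).  So the claim is
  \<open>d\<^sub>M\<^sup>2 \<cdot> Jac\<^sub>M \<cdot> det D = (-1)\<^bsup>n+k\<^esup> det (B\<^sup>T D B)\<close>.

  Let \<open>X\<close>, \<open>P\<close>, \<open>T\<close> be the matrices of derivatives of \<open>z\<close>, \<open>p\<close>, \<open>t\<close> with respect to the coordinates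
  \<open>z\<^sub>M, p\<^bsub>M'\<^esub>\<close>, where \<open>M'\<close> is the complement of \<open>M\<close>; then \<open>Jac\<^sub>M = det X\<close>.  Differentiating the
  equations gives \<open>X = - D\<^sup>-\<^sup>1 P - B T\<close> and \<open>B\<^sup>T P = 0\<close>, while the rows of \<open>X\<close> in \<open>M\<close> and those of \<open>P\<close>
  in \<open>M'\<close> are rows of the identity matrix.  Eliminating \<open>P\<close> leaves a square linear system of size
  \<open>n + k\<close> for the stacked matrix of \<open>X\<close> and \<open>T\<close>.  Its matrix \<open>W\<close> satisfies
  \<open>det W \<cdot> det X = det (B\<^sup>T D B)\<close>, and a column operation gives
  \<open>det W = (-1)\<^bsup>n-k\<^esup> d\<^sub>M\<^sup>2 det D\<close>.  Both steps are in \<open>det_implicit_derivative\<close>.  Working with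
  \<open>n + k\<close> unknowns means that the order of the coordinates never has to be permuted.

  The derivatives exist because the chart has an explicit inverse.  As \<open>d\<^sub>M \<noteq> 0\<close>, the rows of \<open>B\<close> in
  \<open>M\<close> have a dual basis \<open>R\<close>, which solves \<open>B\<^sup>T p = 0\<close> for \<open>p\<^sub>M\<close> and then the equations with \<open>j \<in> M\<close>
  for \<open>t\<close> (locale \<open>dual_frame\<close>).
\<close>

section \<open>Determinants\<close>

lemma sorted_list_of_set_reindex:
  assumes "card M = k" "finite M"
  shows "(\<Sum>l\<in>M. f l) = (\<Sum>r<k. f (sorted_list_of_set M ! r))"
    and "(\<Prod>l\<in>M. g l) = (\<Prod>r<k. g (sorted_list_of_set M ! r))"
proof -
  have "bij_betw (\<lambda>r. sorted_list_of_set M ! r) {..<k} M"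
    using assms by (intro bij_betw_nth) auto
  then show "(\<Sum>l\<in>M. f l) = (\<Sum>r<k. f (sorted_list_of_set M ! r))"
    and "(\<Prod>l\<in>M. g l) = (\<Prod>r<k. g (sorted_list_of_set M ! r))"
    by (simp_all add: sum.reindex_bij_betw prod.reindex_bij_betw)
qed

text \<open>
  Only the \<open>k\<close> rows of \<open>b\<close> in \<open>M\<close> enter, so the matrix is a product of square matrices
  \<open>S\<^sup>T * diag c * S\<close> with \<open>S\<close> formed by these rows.
\<close>

lemma det_weighted_gram:
  fixes b :: "nat \<Rightarrow> nat \<Rightarrow> complex"
  assumes "finite M" "card M = k"
  shows "det (mat k k (\<lambda>(i, j). \<Sum>l\<in>M. c l * b l i * b l j)) = minor_sq k b M * (\<Prod>l\<in>M. c l)"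
proof -
  define s where "s = sorted_list_of_set M"
  define S where "S = mat k k (\<lambda>(r, m). b (s ! r) m)"
  define D where "D = mat_diag k (\<lambda>r. c (s ! r))"
  have S: "S \<in> carrier_mat k k" by (simp add: S_def)
  have ST: "S\<^sup>T \<in> carrier_mat k k" using S by simp
  have D: "D \<in> carrier_mat k k" by (simp add: D_def)
  have "mat k k (\<lambda>(i, j). \<Sum>l\<in>M. c l * b l i * b l j) = S\<^sup>T * (D * S)"
    using S
    by (intro eq_matI)
      (auto simp: sorted_list_of_set_reindex[OF assms(2,1)] D_def S_def mat_diag_mult_left[of _ k k]
        scalar_prod_def s_def lessThan_atLeast0 intro!: sum.cong)
  moreover have "det D = (\<Prod>l\<in>M. c l)"
    unfolding D_def sorted_list_of_set_reindex[OF assms(2,1)]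
    by (subst det_upper_triangular[of _ k])
      (auto simp: mat_diag_def s_def prod_list_diag_prod lessThan_atLeast0)
  ultimately show ?thesis
    using det_mult[OF ST, of "D * S"] det_mult[OF D S] det_transpose[OF S] S D
    by (simp add: minor_sq_def minor_def S_def s_def power2_eq_square algebra_simps)
qed

text \<open>
  The linear algebra of the proof.  The hypotheses \<open>X\<close> and \<open>P\<close> are the differentiated equations of
  the variety, with \<open>c i\<close> for \<open>p\<^sub>i\<^sup>2 / a\<^sub>i\<close>, and \<open>XM\<close> and \<open>PM\<close> say that differentiation is with respect to
  the coordinates \<open>z\<^sub>i\<close> for \<open>i \<in> M\<close> and \<open>p\<^sub>i\<close> for \<open>i \<notin> M\<close>.
\<close>

lemma det_implicit_derivative:
  fixes b X P T :: "nat \<Rightarrow> nat \<Rightarrow> complex" and c :: "nat \<Rightarrow> complex"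
  assumes M: "M \<subseteq> {..<n}" "card M = k"
    and c: "\<And>i. i < n \<Longrightarrow> c i \<noteq> 0"
    and X: "\<And>i j. i < n \<Longrightarrow> j < n \<Longrightarrow> X i j = - P i j / c i - (\<Sum>m<k. b i m * T m j)"
    and P: "\<And>m j. m < k \<Longrightarrow> j < n \<Longrightarrow> (\<Sum>i<n. b i m * P i j) = 0"
    and XM: "\<And>i j. i \<in> M \<Longrightarrow> j < n \<Longrightarrow> X i j = of_bool (i = j)"
    and PM: "\<And>i j. i < n \<Longrightarrow> i \<notin> M \<Longrightarrow> j < n \<Longrightarrow> P i j = of_bool (i = j)"
  shows "minor_sq k b M * det (mat n n (\<lambda>(i, j). X i j)) * (\<Prod>i<n. c i) =
    (-1) ^ (n + k) * det (mat k k (\<lambda>(i, j). \<Sum>l<n. c l * b l i * b l j))"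
proof -
  have fin: "finite M" using M(1) finite_subset by blast
  \<comment> \<open>The upper blocks \<open>A\<close> and \<open>V\<close> of \<open>W\<close> come from \<open>XM\<close> and \<open>PM\<close>, the lower blocks \<open>U\<close> and \<open>G\<close>
    from hypothesis \<open>P\<close>, with every \<open>P i j\<close> replaced by its value obtained from hypothesis \<open>X\<close>.\<close>
  define al where "al i = (if i \<in> M then 1 else - c i)" for i
  define A where "A = mat_diag n al"
  define V where "V = mat n k (\<lambda>(i, m). if i \<in> M then 0 else - c i * b i m)"
  define U where "U = mat k n (\<lambda>(m, i). c i * b i m)"
  define G where "G = mat k k (\<lambda>(i, j). \<Sum>l<n. c l * b l i * b l j)"
  define GM where "GM = mat k k (\<lambda>(i, j). \<Sum>l\<in>M. c l * b l i * b l j)"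
  define Xm where "Xm = mat n n (\<lambda>(i, j). X i j)"
  define Tm where "Tm = mat k n (\<lambda>(i, j). T i j)"
  define E where "E = mat n k (\<lambda>(i, m). if i \<in> M then 0 else - b i m)"
  have car: "A \<in> carrier_mat n n" "V \<in> carrier_mat n k" "U \<in> carrier_mat k n" "G \<in> carrier_mat k k"
    "GM \<in> carrier_mat k k" "Xm \<in> carrier_mat n n" "Tm \<in> carrier_mat k n" "E \<in> carrier_mat n k"
    by (simp_all add: A_def V_def U_def G_def GM_def Xm_def Tm_def E_def)
  define W where "W = four_block_mat A V U G"
  have W: "W \<in> carrier_mat (n + k) (n + k)" using car by (simp add: W_def)
  have PX: "P i j = - c i * (X i j + (\<Sum>m<k. b i m * T m j))" if "i < n" "j < n" for i j
    using X[OF that] c[OF that(1)] by (simp add: field_simps)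
  have e1: "A * Xm + V * Tm = 1\<^sub>m n"
  proof (rule eq_matI)
    fix i j assume "i < dim_row (1\<^sub>m n :: complex mat)" "j < dim_col (1\<^sub>m n :: complex mat)"
    then have ij: "i < n" "j < n" by auto
    have "(A * Xm + V * Tm) $$ (i, j) = al i * X i j + (\<Sum>m<k. (if i \<in> M then 0 else - c i * b i m) * T m j)"
      using ij car unfolding A_def
      by (subst mat_diag_mult_left[of _ n n])
        (auto simp: V_def Xm_def Tm_def scalar_prod_def lessThan_atLeast0)
    also have "\<dots> = of_bool (i = j)"
    proof (cases "i \<in> M")
      case True
      then show ?thesis using XM ij by (simp add: al_def)
    next
      case False
      then show ?thesis using PX[OF ij] PM[OF ij(1) False ij(2)]
        by (simp add: al_def sum_negf sum_distrib_left algebra_simps)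
    qed
    finally show "(A * Xm + V * Tm) $$ (i, j) = 1\<^sub>m n $$ (i, j)" using ij by simp
  qed (use car in auto)
  have e2: "U * Xm + G * Tm = 0\<^sub>m k n"
  proof (rule eq_matI)
    fix m j assume "m < dim_row (0\<^sub>m k n :: complex mat)" "j < dim_col (0\<^sub>m k n :: complex mat)"
    then have mj: "m < k" "j < n" by auto
    have "(U * Xm + G * Tm) $$ (m, j) =
        (\<Sum>i<n. c i * b i m * X i j) + (\<Sum>l<k. (\<Sum>i<n. c i * b i m * b i l) * T l j)"
      using mj car by (auto simp: U_def G_def Xm_def Tm_def scalar_prod_def lessThan_atLeast0)
    also have "(\<Sum>l<k. (\<Sum>i<n. c i * b i m * b i l) * T l j)
        = (\<Sum>i<n. c i * b i m * (\<Sum>l<k. b i l * T l j))"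
      unfolding sum_distrib_right sum_distrib_left by (subst sum.swap) (simp add: mult_ac)
    also have "(\<Sum>i<n. c i * b i m * X i j) + (\<Sum>i<n. c i * b i m * (\<Sum>l<k. b i l * T l j))
        = - (\<Sum>i<n. b i m * P i j)"
      unfolding sum.distrib[symmetric] sum_negf[symmetric]
      using mj by (intro sum.cong) (auto simp: PX algebra_simps)
    finally show "(U * Xm + G * Tm) $$ (m, j) = 0\<^sub>m k n $$ (m, j)" using mj P by simp
  qed (use car in auto)
  have "W * four_block_mat Xm (0\<^sub>m n k) Tm (1\<^sub>m k) = four_block_mat (1\<^sub>m n) V (0\<^sub>m k n) G"
    unfolding W_def using car e1 e2
    by (subst mult_four_block_mat[of _ n n _ k _ k]) (auto intro!: cong_four_block_mat)
  then have d1: "det W * det Xm = det G"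
    using det_mult[OF W, of "four_block_mat Xm (0\<^sub>m n k) Tm (1\<^sub>m k)"] car
      det_four_block_mat_upper_right_zero[of Xm n "0\<^sub>m n k" k Tm "1\<^sub>m k"]
      det_four_block_mat_lower_left_zero[of "1\<^sub>m n" n V k "0\<^sub>m k n" G]
    by simp
  \<comment> \<open>Adding to the last \<open>k\<close> columns of \<open>W\<close> the first \<open>n\<close> columns times \<open>E\<close> clears the block \<open>V\<close> and
    restricts the sum in \<open>G\<close> to \<open>M\<close>.\<close>
  have e3: "A * E + V = 0\<^sub>m n k"
    using car unfolding A_def
    by (subst mat_diag_mult_left[of _ n k]) (auto simp: E_def V_def al_def)
  have e4: "U * E + G = GM"
  proof (rule eq_matI)
    fix i j assume "i < dim_row GM" "j < dim_col GM"
    then have ij: "i < k" "j < k" using car by auto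
    have "(U * E + G) $$ (i, j) = (\<Sum>l<n. c l * b l i * (if l \<in> M then 0 else - b l j))
        + (\<Sum>l<n. c l * b l i * b l j)"
      using ij car by (auto simp: U_def E_def G_def scalar_prod_def lessThan_atLeast0)
    also have "\<dots> = (\<Sum>l<n. if l \<in> M then c l * b l i * b l j else 0)"
      unfolding sum.distrib[symmetric] by (intro sum.cong) auto
    also have "\<dots> = (\<Sum>l\<in>M. c l * b l i * b l j)"
      using M(1) by (simp add: sum.If_cases Int_absorb1)
    finally show "(U * E + G) $$ (i, j) = GM $$ (i, j)" using ij by (simp add: GM_def)
  qed (use car in auto)
  have "W * four_block_mat (1\<^sub>m n) E (0\<^sub>m k n) (1\<^sub>m k) =
      four_block_mat (A * 1\<^sub>m n + V * 0\<^sub>m k n) (A * E + V * 1\<^sub>m k)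
        (U * 1\<^sub>m n + G * 0\<^sub>m k n) (U * E + G * 1\<^sub>m k)"
    unfolding W_def by (rule mult_four_block_mat[of _ n n _ k _ k _ _ n _ k]) (use car in simp_all)
  also have "\<dots> = four_block_mat A (0\<^sub>m n k) U GM"
    using car by (simp add: e3 e4)
  finally have "W * four_block_mat (1\<^sub>m n) E (0\<^sub>m k n) (1\<^sub>m k) =
      four_block_mat A (0\<^sub>m n k) U GM" .
  then have "det W = det A * det GM"
    using det_mult[OF W, of "four_block_mat (1\<^sub>m n) E (0\<^sub>m k n) (1\<^sub>m k)"] car
      det_four_block_mat_lower_left_zero[of "1\<^sub>m n" n E k "0\<^sub>m k n" "1\<^sub>m k"]
      det_four_block_mat_upper_right_zero[of A n "0\<^sub>m n k" k U GM]
    by simp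
  moreover have "det GM = minor_sq k b M * (\<Prod>l\<in>M. c l)"
    unfolding GM_def by (rule det_weighted_gram[OF fin M(2)])
  moreover have "det A = (-1) ^ (n + k) * (\<Prod>i\<in>{..<n} - M. c i)"
  proof -
    have "det A = (\<Prod>i<n. al i)"
      unfolding A_def
      by (subst det_upper_triangular[of _ n]) (auto simp: mat_diag_def prod_list_diag_prod lessThan_atLeast0)
    also have "\<dots> = (\<Prod>i\<in>{..<n} - M. - c i)"
      unfolding al_def by (intro prod.mono_neutral_cong_right) auto
    also have "\<dots> = (-1) ^ card ({..<n} - M) * (\<Prod>i\<in>{..<n} - M. c i)"
      by (simp add: prod_uminus)
    also have "card ({..<n} - M) = n - k" using M fin by (simp add: card_Diff_subset)
    also have "(-1 :: complex) ^ (n - k) = (-1) ^ (n + k)"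
      using card_mono[OF _ M(1)] M(2) by (simp add: uminus_power_if)
    finally show ?thesis .
  qed
  moreover have "(\<Prod>i<n. c i) = (\<Prod>i\<in>{..<n} - M. c i) * (\<Prod>l\<in>M. c l)"
    using prod.subset_diff[OF M(1), of c] by simp
  ultimately have dW: "det W = (-1) ^ (n + k) * minor_sq k b M * (\<Prod>i<n. c i)"
    by (simp only: mult_ac)
  have sq: "((-1) ^ (n + k) :: complex) * (-1) ^ (n + k) = 1"
    by (simp add: power_add[symmetric])
  have "minor_sq k b M * det Xm * (\<Prod>i<n. c i) =
    ((-1) ^ (n + k) * (-1) ^ (n + k)) * (minor_sq k b M * det Xm * (\<Prod>i<n. c i))" by (simp add: sq)
  also have "\<dots> = (-1) ^ (n + k) * (det W * det Xm)"
    by (simp only: dW mult_ac)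
  finally show ?thesis unfolding d1 by (simp only: Xm_def G_def)
qed

section \<open>Derivatives of the master function\<close>

lemma f_fun_shift_t:
  assumes "t \<in> carrier_vec k" "i < k"
  shows "f_fun k b l z (t + s \<cdot>\<^sub>v unit_vec (dim_vec t) i) = f_fun k b l z t + s * b l i"
proof -
  have "lin_form k b l (t + s \<cdot>\<^sub>v unit_vec (dim_vec t) i)
      = (\<Sum>m<k. b l m * t $ m + (if m = i then s * b l i else 0))"
    unfolding lin_form_def using assms by (intro sum.cong) (auto simp: algebra_simps)
  then show ?thesis
    using assms by (simp add: f_fun_def lin_form_def sum.distrib)
qed

lemma partial_t_master:
  assumes "t' \<in> carrier_vec k" "i < k"
    and "\<And>l. l < n \<Longrightarrow> f_fun k b l z t \<noteq> 0"
    and "\<And>l. l < n \<Longrightarrow> f_fun k b l z t' / f_fun k b l z t \<notin> \<real>\<^sub>\<le>\<^sub>0"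
  shows "partial i (\<lambda>t'. master n k b a z t z t') t' = (\<Sum>l<n. a l * b l i / f_fun k b l z t')"
proof -
  have d: "((\<lambda>s. a l * log_branch (f_fun k b l z t) (f_fun k b l z t' + s * b l i))
      has_field_derivative a l * b l i / f_fun k b l z t') (at 0)" if l: "l < n" for l
  proof -
    have "((\<lambda>s. log_branch (f_fun k b l z t) (f_fun k b l z t' + s * b l i))
      has_field_derivative 1 / f_fun k b l z t' * b l i) (at 0)"
    proof (rule DERIV_chain2[where f = "log_branch (f_fun k b l z t)" and g = "\<lambda>s. f_fun k b l z t' + s * b l i"])
      show "(log_branch (f_fun k b l z t) has_field_derivative 1 / f_fun k b l z t')
          (at (f_fun k b l z t' + 0 * b l i))"
        using log_branch_has_derivative[OF assms(3)[OF l] assms(4)[OF l]] by simp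
      show "((\<lambda>s. f_fun k b l z t' + s * b l i) has_field_derivative b l i) (at 0)"
        by (auto intro!: derivative_eq_intros)
    qed
    from DERIV_cmult[OF this, of "a l"] show ?thesis by simp
  qed
  have "((\<lambda>s. \<Sum>l<n. a l * log_branch (f_fun k b l z t) (f_fun k b l z t' + s * b l i))
      has_field_derivative (\<Sum>l<n. a l * b l i / f_fun k b l z t')) (at 0)"
    by (rule DERIV_sum) (use d in auto)
  then show ?thesis
    unfolding partial_def master_def f_fun_shift_t[OF assms(1,2)]
    by (simp add: DERIV_imp_deriv)
qed

text \<open>
  The branch of the master function stays based at \<open>(z, t)\<close>, so the formula for the first derivative
  is available only near \<open>t\<close>; this suffices for differentiating it at \<open>t\<close>.
\<close>

lemma partial2_t_master:
  assumes "t \<in> carrier_vec k" "i < k" "j < k"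
    and nz: "\<And>l. l < n \<Longrightarrow> f_fun k b l z t \<noteq> 0"
  shows "partial i (partial j (\<lambda>t'. master n k b a z t z t')) t =
    - (\<Sum>l<n. a l / (f_fun k b l z t)\<^sup>2 * b l i * b l j)"
proof -
  define F where "F l s = f_fun k b l z t + s * b l i" for l s
  have F0: "F l 0 = f_fun k b l z t" for l by (simp add: F_def)
  have cont: "((\<lambda>s. F l s / f_fun k b l z t) \<longlongrightarrow> 1) (nhds 0)" if "l < n" for l
  proof -
    have "isCont (\<lambda>s. F l s / f_fun k b l z t) 0"
      unfolding F_def using nz[OF that] by (intro continuous_intros) auto
    then have "((\<lambda>s. F l s / f_fun k b l z t) \<longlongrightarrow> F l 0 / f_fun k b l z t) (nhds 0)"
      unfolding isCont_def by (rule tendsto_at_iff_tendsto_nhds[THEN iffD1])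
    then show ?thesis using nz[OF that] by (simp add: F0)
  qed
  have "\<forall>\<^sub>F s in nhds 0. \<forall>l\<in>{..<n}. F l s / f_fun k b l z t \<notin> \<real>\<^sub>\<le>\<^sub>0"
  proof (intro eventually_ball_finite ballI)
    fix l assume "l \<in> {..<n}"
    then have l: "l < n" by simp
    have "open (- \<real>\<^sub>\<le>\<^sub>0 :: complex set)" by (simp add: open_Compl)
    from topological_tendstoD[OF cont[OF l] this]
    show "\<forall>\<^sub>F s in nhds 0. F l s / f_fun k b l z t \<notin> \<real>\<^sub>\<le>\<^sub>0" by simp
  qed simp
  then have "\<forall>\<^sub>F s in nhds 0.
      partial j (\<lambda>t'. master n k b a z t z t') (t + s \<cdot>\<^sub>v unit_vec (dim_vec t) i) =
      (\<Sum>l<n. a l * b l j / F l s)"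
  proof eventually_elim
    case (elim s)
    then show ?case
      using assms(1-3) partial_t_master[of "t + s \<cdot>\<^sub>v unit_vec (dim_vec t) i" k j n b z t a] nz
      unfolding F_def f_fun_shift_t[OF assms(1,2)] by simp
  qed
  then have "partial i (partial j (\<lambda>t'. master n k b a z t z t')) t =
      deriv (\<lambda>s. \<Sum>l<n. a l * b l j / F l s) 0"
    unfolding partial_def[of i] by (rule deriv_cong_ev) simp
  also have "\<dots> = (\<Sum>l<n. - (a l / (f_fun k b l z t)\<^sup>2 * b l i * b l j))"
    unfolding F_def using nz
    by (intro DERIV_imp_deriv DERIV_sum)
      (auto intro!: derivative_eq_intros simp: power2_eq_square)
  finally show ?thesis by (simp add: sum_negf)
qed

section \<open>The variety\<close>

lemma critical_set_iff:
  "(z, t) \<in> critical_set n k b a \<longleftrightarrow>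
    (z, t) \<in> U0 n k b \<and> (\<forall>i<k. (\<Sum>l<n. a l * b l i / f_fun k b l z t) = 0)"
proof -
  have "partial i (\<lambda>t'. master n k b a z t z t') t = (\<Sum>l<n. a l * b l i / f_fun k b l z t)"
    if "(z, t) \<in> U0 n k b" "i < k" for i
    using that by (intro partial_t_master) (auto simp: U0_def)
  then show ?thesis by (auto simp: critical_set_def)
qed

lemma phi_map_eq:
  assumes "(z, t) \<in> U0 n k b"
  shows "phi_map n k b a (z, t) = (z, vec n (\<lambda>j. a j / f_fun k b j z t))"
  using assms by (auto simp: phi_map_def U0_def partial_z_master intro!: eq_vecI)

lemma Lam_iff:
  assumes "\<And>j. j < n \<Longrightarrow> a j \<noteq> 0"
  shows "(z, p) \<in> Lam n k b a \<longleftrightarrow>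
    (\<exists>t\<in>carrier_vec k. z \<in> carrier_vec n - discriminant n k b \<and> p \<in> carrier_vec n \<and>
      (\<forall>j<n. p $ j \<noteq> 0 \<and> z $ j = a j / p $ j - lin_form k b j t) \<and>
      (\<forall>m<k. (\<Sum>l<n. b l m * p $ l) = 0))"
    (is "_ \<longleftrightarrow> (\<exists>t\<in>_. ?P t)")
proof
  assume "(z, p) \<in> Lam n k b a"
  then obtain z' t where t': "(z', t) \<in> critical_set n k b a" "(z, p) = phi_map n k b a (z', t)"
    unfolding Lam_def by auto
  then have U: "(z', t) \<in> U0 n k b" by (simp add: critical_set_iff)
  have z': "z' = z" and p: "p = vec n (\<lambda>j. a j / f_fun k b j z t)"
    using t'(2) by (auto simp: phi_map_eq[OF U])
  have nz: "f_fun k b j z t \<noteq> 0" if "j < n" for j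
    using U that by (auto simp: U0_def z')
  have "p $ j \<noteq> 0 \<and> z $ j = a j / p $ j - lin_form k b j t" if "j < n" for j
    using nz[OF that] assms[OF that] that by (simp add: p) (simp add: f_fun_def)
  moreover have "(\<Sum>l<n. b l m * p $ l) = 0" if "m < k" for m
  proof -
    have "(\<Sum>l<n. b l m * p $ l) = (\<Sum>l<n. a l * b l m / f_fun k b l z t)"
      by (intro sum.cong) (auto simp: p)
    then show ?thesis using t'(1) that by (simp add: critical_set_iff z')
  qed
  moreover have "t \<in> carrier_vec k" "z \<in> carrier_vec n - discriminant n k b"
    using U by (auto simp: U0_def z')
  ultimately have "?P t" "t \<in> carrier_vec k"
    by (simp_all add: p)
  then show "\<exists>t\<in>carrier_vec k. ?P t" by blast
next
  assume "\<exists>t\<in>carrier_vec k. ?P t"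
  then obtain t where t: "t \<in> carrier_vec k" "?P t" by blast
  have f: "f_fun k b j z t = a j / p $ j" if "j < n" for j
    using t that by (simp add: f_fun_def)
  have U: "(z, t) \<in> U0 n k b"
    using t assms by (auto simp: U0_def f)
  have "(z, t) \<in> critical_set n k b a"
  proof -
    have "(\<Sum>l<n. a l * b l m / f_fun k b l z t) = (\<Sum>l<n. b l m * p $ l)" for m
      using assms t(2) by (intro sum.cong) (auto simp: f)
    then show ?thesis using U t by (simp add: critical_set_iff)
  qed
  moreover have "phi_map n k b a (z, t) = (z, p)"
    using U t assms by (auto simp: phi_map_eq f intro!: eq_vecI)
  ultimately show "(z, p) \<in> Lam n k b a" unfolding Lam_def by (metis image_eqI)
qed

text \<open>
  The discriminant is a finite union of hyperplanes, hence its complement is open; the form with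
  coordinates avoids a topology on \<open>complex vec\<close>.
\<close>

lemma eventually_notin_discriminant:
  assumes lim: "\<And>i. i < n \<Longrightarrow> ((\<lambda>s. u s $ i) \<longlongrightarrow> z $ i) F"
    and z: "z \<in> carrier_vec n - discriminant n k b"
  shows "\<forall>\<^sub>F s in F. u s \<notin> discriminant n k b"
proof -
  define I where "I = {idx. set idx \<subseteq> {..<n} \<and> length idx = k + 1}"
  have "\<forall>\<^sub>F s in F. \<forall>idx\<in>I. sorted_wrt (<) idx \<longrightarrow> f_tuple k b idx (u s) \<noteq> 0"
  proof (intro eventually_ball_finite ballI)
    show "finite I" unfolding I_def by (rule finite_lists_length_eq) simp
  next
    fix idx assume idx: "idx \<in> I"
    show "\<forall>\<^sub>F s in F. sorted_wrt (<) idx \<longrightarrow> f_tuple k b idx (u s) \<noteq> 0"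
    proof (cases "sorted_wrt (<) idx")
      case True
      have "((\<lambda>s. f_tuple k b idx (u s)) \<longlongrightarrow> f_tuple k b idx z) F"
        unfolding f_tuple_def
      proof (intro tendsto_sum tendsto_mult tendsto_const lim)
        fix m assume "m \<in> {..<k + 1}"
        then have "idx ! m \<in> set idx" using idx by (auto simp: I_def)
        then show "idx ! m < n" using idx by (auto simp: I_def)
      qed
      moreover have "f_tuple k b idx z \<noteq> 0"
        using z True idx by (auto simp: discriminant_def I_def)
      ultimately show ?thesis
        by (auto dest: tendsto_imp_eventually_ne elim: eventually_mono)
    qed simp
  qed
  then show ?thesis
    by eventually_elim (auto simp: discriminant_def I_def)
qed

section \<open>The inverse of the chart\<close>

text \<open>
  The matrix \<open>R\<close> is a two-sided inverse of the square matrix formed by the rows of \<open>b\<close> in \<open>M\<close>.  Its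
  columns are indexed by the elements of \<open>M\<close> themselves rather than by their ranks, so that no
  enumeration of \<open>M\<close> appears below.
\<close>

locale dual_frame =
  fixes n k :: nat and b :: "nat \<Rightarrow> nat \<Rightarrow> complex" and a :: "nat \<Rightarrow> complex"
    and M :: "nat set" and R :: "nat \<Rightarrow> nat \<Rightarrow> complex"
  assumes M: "M \<subseteq> {..<n}"
    and a: "\<And>j. j < n \<Longrightarrow> a j \<noteq> 0"
    and left: "\<And>i m. i < k \<Longrightarrow> m < k \<Longrightarrow> (\<Sum>j\<in>M. R i j * b j m) = of_bool (i = m)"
    and right: "\<And>j l. j \<in> M \<Longrightarrow> l \<in> M \<Longrightarrow> (\<Sum>i<k. b j i * R i l) = of_bool (j = l)"
begin

text \<open>
  The point of \<open>\<Lambda>\<close> with given coordinates \<open>x\<close>: first \<open>p\<close> from \<open>B\<^sup>T p = 0\<close>, then \<open>t\<close> from the equations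
  \<open>g\<^sub>j(t) = a\<^sub>j / p\<^sub>j - x\<^sub>j\<close> for \<open>j \<in> M\<close>, and finally \<open>z\<close>.
\<close>

definition p_of :: "complex vec \<Rightarrow> nat \<Rightarrow> complex" where
  "p_of x j = (if j \<in> M then - (\<Sum>i<k. (\<Sum>l\<in>{..<n} - M. b l i * x $ l) * R i j) else x $ j)"

definition t_of :: "complex vec \<Rightarrow> nat \<Rightarrow> complex" where
  "t_of x i = (\<Sum>j\<in>M. R i j * (a j / p_of x j - x $ j))"

definition z_of :: "complex vec \<Rightarrow> nat \<Rightarrow> complex" where
  "z_of x j = a j / p_of x j - (\<Sum>m<k. b j m * t_of x m)"

definition param :: "complex vec \<Rightarrow> complex vec \<times> complex vec" where
  "param x = (vec n (z_of x), vec n (p_of x))"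

lemma finite_M: "finite M"
  using M finite_subset by blast

lemma sum_split_M: "(\<Sum>l<n. f l) = (\<Sum>l\<in>M. f l) + (\<Sum>l\<in>{..<n} - M. f l)" for f :: "nat \<Rightarrow> complex"
  using sum.subset_diff[OF M, of f] by simp

lemma in_Lam_iff:
  "(z, p) \<in> Lam n k b a \<longleftrightarrow>
    (\<exists>t\<in>carrier_vec k. z \<in> carrier_vec n - discriminant n k b \<and> p \<in> carrier_vec n \<and>
      (\<forall>j<n. p $ j \<noteq> 0 \<and> z $ j = a j / p $ j - lin_form k b j t) \<and>
      (\<forall>m<k. (\<Sum>l<n. b l m * p $ l) = 0))"
  by (rule Lam_iff) (rule a)

lemma p_of_kernel:
  assumes "m < k"
  shows "(\<Sum>l<n. b l m * p_of x l) = 0"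
proof -
  define e where "e i = (\<Sum>l\<in>{..<n} - M. b l i * x $ l)" for i
  have p: "p_of x l = - (\<Sum>i<k. e i * R i l)" if "l \<in> M" for l
    using that by (simp add: p_of_def e_def)
  have "(\<Sum>l\<in>M. b l m * p_of x l) = - (\<Sum>l\<in>M. \<Sum>i<k. e i * (R i l * b l m))"
    unfolding sum_negf[symmetric]
    by (intro sum.cong refl) (simp add: p sum_negf sum_distrib_left mult_ac)
  also have "\<dots> = - (\<Sum>i<k. e i * (\<Sum>l\<in>M. R i l * b l m))"
    by (subst sum.swap) (simp add: sum_distrib_left)
  also have "(\<Sum>i<k. e i * (\<Sum>l\<in>M. R i l * b l m)) = (\<Sum>i<k. if i = m then e i else 0)"
    using assms left by (intro sum.cong) auto
  also have "\<dots> = e m" using assms by simp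
  finally have "(\<Sum>l\<in>M. b l m * p_of x l) = - e m" .
  moreover have "(\<Sum>l\<in>{..<n} - M. b l m * p_of x l) = e m"
    unfolding e_def by (intro sum.cong) (auto simp: p_of_def)
  ultimately show ?thesis by (simp add: sum_split_M)
qed

lemma z_of_M:
  assumes "j \<in> M"
  shows "z_of x j = x $ j"
proof -
  have "(\<Sum>m<k. b j m * t_of x m)
      = (\<Sum>l\<in>M. (\<Sum>m<k. b j m * R m l) * (a l / p_of x l - x $ l))"
    unfolding t_of_def sum_distrib_left sum_distrib_right by (subst sum.swap) (simp add: mult_ac)
  also have "\<dots> = (\<Sum>l\<in>M. if l = j then a j / p_of x j - x $ j else 0)"
    using right assms by (intro sum.cong) auto
  also have "\<dots> = a j / p_of x j - x $ j" using finite_M assms by simp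
  finally show ?thesis by (simp add: z_of_def)
qed

lemma chart_param:
  assumes "x \<in> carrier_vec n"
  shows "chart n M (param x) = x"
  using assms M by (auto simp: chart_def param_def z_of_M p_of_def intro!: eq_vecI)

lemma param_in_Lam:
  assumes "\<And>j. j < n \<Longrightarrow> p_of x j \<noteq> 0" "vec n (z_of x) \<notin> discriminant n k b"
  shows "param x \<in> Lam n k b a"
  unfolding param_def in_Lam_iff
proof (intro bexI[of _ "vec k (t_of x)"] conjI allI impI)
  show "vec n (z_of x) \<in> carrier_vec n - discriminant n k b" using assms by simp
qed (use assms p_of_kernel in \<open>auto simp: z_of_def lin_form_def\<close>)

lemma param_chart:
  assumes "(z, p) \<in> Lam n k b a"
  shows "param (chart n M (z, p)) = (z, p)"
proof -
  define x where "x = chart n M (z, p)"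
  from assms obtain t where t: "t \<in> carrier_vec k" "z \<in> carrier_vec n" "p \<in> carrier_vec n"
    "\<And>j. j < n \<Longrightarrow> z $ j = a j / p $ j - lin_form k b j t"
    "\<And>m. m < k \<Longrightarrow> (\<Sum>l<n. b l m * p $ l) = 0"
    unfolding in_Lam_iff by blast
  have xM: "x $ j = z $ j" if "j \<in> M" for j
    using that M by (auto simp: x_def chart_def)
  have xN: "x $ j = p $ j" if "j < n" "j \<notin> M" for j
    using that by (auto simp: x_def chart_def)
  have p: "p_of x j = p $ j" if "j < n" for j
  proof (cases "j \<in> M")
    case True
    have "p_of x j = (\<Sum>i<k. (\<Sum>l\<in>M. b l i * p $ l) * R i j)"
      unfolding p_of_def sum_negf[symmetric] if_P[OF True]
    proof (intro sum.cong refl)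
      fix i assume "i \<in> {..<k}"
      then have "(\<Sum>l\<in>M. b l i * p $ l) = - (\<Sum>l\<in>{..<n} - M. b l i * p $ l)"
        using t(5)[of i] by (simp add: sum_split_M eq_neg_iff_add_eq_0)
      then show "- ((\<Sum>l\<in>{..<n} - M. b l i * x $ l) * R i j) = (\<Sum>l\<in>M. b l i * p $ l) * R i j"
        by (simp add: xN)
    qed
    also have "\<dots> = (\<Sum>l\<in>M. (\<Sum>i<k. b l i * R i j) * p $ l)"
      unfolding sum_distrib_left sum_distrib_right by (subst sum.swap) (simp add: mult_ac)
    also have "\<dots> = (\<Sum>l\<in>M. if l = j then p $ j else 0)"
      using right True by (intro sum.cong) auto
    also have "\<dots> = p $ j" using True finite_M by simp
    finally show ?thesis .
  qed (use that xN in \<open>simp add: p_of_def\<close>)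
  have tt: "t_of x i = t $ i" if "i < k" for i
  proof -
    have "t_of x i = (\<Sum>j\<in>M. R i j * lin_form k b j t)"
      unfolding t_of_def using M t(4) by (intro sum.cong) (auto simp: p xM subset_iff)
    also have "\<dots> = (\<Sum>m<k. (\<Sum>j\<in>M. R i j * b j m) * t $ m)"
      unfolding lin_form_def sum_distrib_left sum_distrib_right
      by (subst sum.swap) (simp add: mult_ac)
    also have "\<dots> = (\<Sum>m<k. if m = i then t $ i else 0)"
      using left that by (intro sum.cong) auto
    finally show ?thesis using that by simp
  qed
  have "z_of x j = z $ j" if "j < n" for j
    using t(4)[OF that] by (simp add: z_of_def p[OF that] tt lin_form_def)
  then show ?thesis using t p by (auto simp: param_def x_def[symmetric] intro!: eq_vecI)
qed

lemma the_inv_into_chart: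
  assumes "x \<in> carrier_vec n" "\<And>j. j < n \<Longrightarrow> p_of x j \<noteq> 0"
    "vec n (z_of x) \<notin> discriminant n k b"
  shows "the_inv_into (Lam n k b a) (chart n M) x = param x"
proof (rule the_inv_into_f_eq)
  show "inj_on (chart n M) (Lam n k b a)"
    by (rule inj_on_inverseI[of _ param]) (auto simp: param_chart)
qed (use assms in \<open>auto intro: chart_param param_in_Lam\<close>)

text \<open>The value \<open>p\<^sub>j\<close> determines \<open>f\<^sub>j\<close>, hence \<open>g\<^sub>j(t)\<close>, and the \<open>g\<^sub>j\<close> with \<open>j \<in> M\<close> determine \<open>t\<close>.\<close>

lemma phi_map_inj: "inj_on (phi_map n k b a) (critical_set n k b a)"
proof (rule inj_onI, clarify)
  fix z t z' t'
  assume c: "(z, t) \<in> critical_set n k b a" "(z', t') \<in> critical_set n k b a"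
    and eq: "phi_map n k b a (z, t) = phi_map n k b a (z', t')"
  have U: "(z, t) \<in> U0 n k b" "(z', t') \<in> U0 n k b" using c by (auto simp: critical_set_iff)
  have z: "z' = z" and p: "vec n (\<lambda>j. a j / f_fun k b j z t) = vec n (\<lambda>j. a j / f_fun k b j z' t')"
    using eq by (auto simp: phi_map_eq[OF U(1)] phi_map_eq[OF U(2)])
  have lin: "lin_form k b j t = lin_form k b j t'" if "j < n" for j
  proof -
    have "a j / f_fun k b j z t = a j / f_fun k b j z t'"
      using arg_cong[OF p, of "\<lambda>v. v $ j"] that z by simp
    then have "f_fun k b j z t = f_fun k b j z t'"
      using a[OF that] U that z by (auto simp: U0_def frac_eq_eq)
    then show ?thesis by (simp add: f_fun_def)
  qed
  have rec: "(\<Sum>j\<in>M. R i j * lin_form k b j v) = v $ i" if "i < k" for i v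
  proof -
    have "(\<Sum>j\<in>M. R i j * lin_form k b j v) = (\<Sum>m<k. (\<Sum>j\<in>M. R i j * b j m) * v $ m)"
      unfolding lin_form_def sum_distrib_left sum_distrib_right
      by (subst sum.swap) (simp add: mult_ac)
    also have "\<dots> = (\<Sum>m<k. if m = i then v $ i else 0)"
      using left that by (intro sum.cong) auto
    finally show ?thesis using that by simp
  qed
  have "t $ i = t' $ i" if "i < k" for i
    unfolding rec[OF that, symmetric] using M lin by (intro sum.cong) auto
  then have "t = t'" using U by (intro eq_vecI) (auto simp: U0_def)
  with z show "z = z' \<and> t = t'" by simp
qed

lemma p_of_shift:
  assumes "x \<in> carrier_vec n" "i < n" "j < n"
  shows "p_of (x + s \<cdot>\<^sub>v unit_vec n j) i = p_of x i + s * p_of (unit_vec n j) i"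
proof (cases "i \<in> M")
  case True
  have "(\<Sum>l\<in>{..<n} - M. b l m * (x + s \<cdot>\<^sub>v unit_vec n j) $ l) =
    (\<Sum>l\<in>{..<n} - M. b l m * x $ l) + s * (\<Sum>l\<in>{..<n} - M. b l m * unit_vec n j $ l)" for m
    unfolding sum_distrib_left sum.distrib[symmetric] using assms
    by (intro sum.cong) (auto simp: algebra_simps)
  then show ?thesis using True
    by (simp add: p_of_def algebra_simps sum.distrib sum_distrib_left)
qed (use assms in \<open>auto simp: p_of_def\<close>)

section \<open>The Hessian and the Jacobian\<close>

lemma Hess_Lam_eq:
  assumes "(z, p) \<in> Lam n k b a"
  shows "Hess_Lam n k b a (z, p) =
    (-1) ^ k * det (mat k k (\<lambda>(i, j). \<Sum>l<n. (p $ l)\<^sup>2 / a l * b l i * b l j))"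
proof -
  from assms obtain z' t where c: "(z', t) \<in> critical_set n k b a"
    and "(z, p) = phi_map n k b a (z', t)"
    unfolding Lam_def by auto
  moreover have U: "(z', t) \<in> U0 n k b" using c by (simp add: critical_set_iff)
  ultimately have phi: "phi_map n k b a (z, t) = (z, p)" and "z' = z"
    and p: "p = vec n (\<lambda>j. a j / f_fun k b j z t)"
    by (auto simp: phi_map_eq)
  note c = c[unfolded \<open>z' = z\<close>] and U = U[unfolded \<open>z' = z\<close>]
  have "the_inv_into (critical_set n k b a) (phi_map n k b a) (z, p) = (z, t)"
    by (rule the_inv_into_f_eq[OF phi_map_inj phi c])
  then have "Hess_Lam n k b a (z, p) = det (mat k k (\<lambda>(i, j).
      partial i (partial j (\<lambda>t'. master n k b a z t z t')) t))"
    by (simp add: Hess_Lam_def Hess_def)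
  also have "mat k k (\<lambda>(i, j). partial i (partial j (\<lambda>t'. master n k b a z t z t')) t) =
      (-1) \<cdot>\<^sub>m mat k k (\<lambda>(i, j). \<Sum>l<n. (p $ l)\<^sup>2 / a l * b l i * b l j)"
  proof (rule eq_matI)
    fix i j
    assume "i < dim_row ((-1) \<cdot>\<^sub>m mat k k (\<lambda>(i, j). \<Sum>l<n. (p $ l)\<^sup>2 / a l * b l i * b l j))"
      "j < dim_col ((-1) \<cdot>\<^sub>m mat k k (\<lambda>(i, j). \<Sum>l<n. (p $ l)\<^sup>2 / a l * b l i * b l j))"
    then have ij: "i < k" "j < k" by auto
    have "partial i (partial j (\<lambda>t'. master n k b a z t z t')) t =
        - (\<Sum>l<n. a l / (f_fun k b l z t)\<^sup>2 * b l i * b l j)"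
      using U ij by (intro partial2_t_master) (auto simp: U0_def)
    also have "(\<Sum>l<n. a l / (f_fun k b l z t)\<^sup>2 * b l i * b l j) =
        (\<Sum>l<n. (p $ l)\<^sup>2 / a l * b l i * b l j)"
      using a by (intro sum.cong) (auto simp: p power_divide power2_eq_square)
    finally show "mat k k (\<lambda>(i, j). partial i (partial j (\<lambda>t'. master n k b a z t z t')) t) $$ (i, j)
        = ((-1) \<cdot>\<^sub>m mat k k (\<lambda>(i, j). \<Sum>l<n. (p $ l)\<^sup>2 / a l * b l i * b l j)) $$ (i, j)"
      using ij by simp
  qed simp_all
  finally show ?thesis by (simp add: det_smult)
qed

text \<open>
  The matrices of derivatives of \<open>p\<close>, \<open>t\<close> and \<open>z\<close> with respect to the coordinates \<open>x\<close>.  The first is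
  constant because \<open>p\<close> depends linearly on \<open>x\<close>.
\<close>

definition P_der :: "nat \<Rightarrow> nat \<Rightarrow> complex" where
  "P_der i j = p_of (unit_vec n j) i"

definition T_der :: "complex vec \<Rightarrow> nat \<Rightarrow> nat \<Rightarrow> complex" where
  "T_der x m j = (\<Sum>l\<in>M. R m l * (- a l / (p_of x l)\<^sup>2 * P_der l j - of_bool (l = j)))"

definition X_der :: "complex vec \<Rightarrow> nat \<Rightarrow> nat \<Rightarrow> complex" where
  "X_der x i j = - P_der i j / ((p_of x i)\<^sup>2 / a i) - (\<Sum>m<k. b i m * T_der x m j)"

context
  fixes x :: "complex vec" and j :: nat
  assumes x: "x \<in> carrier_vec n" and j: "j < n" and nz: "\<And>i. i < n \<Longrightarrow> p_of x i \<noteq> 0"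
begin

lemma has_derivative_p_of:
  assumes "i < n"
  shows "((\<lambda>s. p_of (x + s \<cdot>\<^sub>v unit_vec n j) i) has_field_derivative P_der i j) (at 0)"
  unfolding p_of_shift[OF x assms j] P_der_def by (auto intro!: derivative_eq_intros)

lemma has_derivative_inverse_p_of:
  assumes "i < n"
  shows "((\<lambda>s. a i / p_of (x + s \<cdot>\<^sub>v unit_vec n j) i)
    has_field_derivative - a i / (p_of x i)\<^sup>2 * P_der i j) (at 0)"
  unfolding p_of_shift[OF x assms j] P_der_def
  using nz[OF assms] by (auto intro!: derivative_eq_intros simp: power2_eq_square)

lemma has_derivative_t_of:
  "((\<lambda>s. t_of (x + s \<cdot>\<^sub>v unit_vec n j) m) has_field_derivative T_der x m j) (at 0)"
proof -
  have d: "((\<lambda>s. R m l * (a l / p_of (x + s \<cdot>\<^sub>v unit_vec n j) l - (x + s \<cdot>\<^sub>v unit_vec n j) $ l))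
      has_field_derivative R m l * (- a l / (p_of x l)\<^sup>2 * P_der l j - of_bool (l = j))) (at 0)"
    if "l \<in> M" for l
  proof -
    have l: "l < n" using that M by auto
    have "((\<lambda>s. (x + s \<cdot>\<^sub>v unit_vec n j) $ l) has_field_derivative of_bool (l = j)) (at 0)"
      using x j l by (auto intro!: derivative_eq_intros)
    from DERIV_cmult[OF DERIV_diff[OF has_derivative_inverse_p_of[OF l] this], of "R m l"]
    show ?thesis .
  qed
  show ?thesis unfolding t_of_def T_der_def by (rule DERIV_sum) (use d in auto)
qed

lemma has_derivative_z_of:
  assumes "i < n"
  shows "((\<lambda>s. z_of (x + s \<cdot>\<^sub>v unit_vec n j) i) has_field_derivative X_der x i j) (at 0)"
proof -
  have "((\<lambda>s. \<Sum>m<k. b i m * t_of (x + s \<cdot>\<^sub>v unit_vec n j) m)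
      has_field_derivative (\<Sum>m<k. b i m * T_der x m j)) (at 0)"
    by (rule DERIV_sum) (use DERIV_cmult[OF has_derivative_t_of] in auto)
  from DERIV_diff[OF has_derivative_inverse_p_of[OF assms] this]
  show ?thesis unfolding z_of_def X_der_def by (simp add: mult.commute)
qed

end

text \<open>
  The conditions \<open>p\<^sub>j \<noteq> 0\<close> and \<open>z \<notin> \<Delta>\<close> persist along a short segment in each coordinate direction, and
  there the inverse of the chart is given by \<open>param\<close>.
\<close>

lemma partial_inverse_chart:
  assumes q: "(z, p) \<in> Lam n k b a" and i: "i < n" and j: "j < n"
  shows "partial j (\<lambda>x. fst (the_inv_into (Lam n k b a) (chart n M) x) $ i) (chart n M (z, p)) =
    X_der (chart n M (z, p)) i j"
proof -
  define x where "x = chart n M (z, p)"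
  have x: "x \<in> carrier_vec n" by (simp add: x_def chart_def)
  have pa: "vec n (z_of x) = z" "vec n (p_of x) = p"
    using param_chart[OF q] by (auto simp: param_def x_def)
  have nz: "p_of x l \<noteq> 0" if "l < n" for l
    using q that unfolding in_Lam_iff pa(2)[symmetric] by auto
  have zd: "vec n (z_of x) \<in> carrier_vec n - discriminant n k b"
    using q unfolding in_Lam_iff pa(1) by auto
  define y where "y s = x + s \<cdot>\<^sub>v unit_vec n j" for s
  have y: "y s \<in> carrier_vec n" and y0: "y 0 = x" for s
    using x by (auto simp: y_def)
  have lim: "(g \<longlongrightarrow> g 0) (nhds 0)" if "(g has_field_derivative D) (at 0)" for g :: "complex \<Rightarrow> complex" and D
    using DERIV_isCont[OF that] unfolding isCont_def by (rule tendsto_at_iff_tendsto_nhds[THEN iffD1])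
  have "\<forall>\<^sub>F s in nhds 0. \<forall>l\<in>{..<n}. p_of (y s) l \<noteq> 0"
  proof (intro eventually_ball_finite ballI)
    fix l assume "l \<in> {..<n}"
    then have l: "l < n" by simp
    show "\<forall>\<^sub>F s in nhds 0. p_of (y s) l \<noteq> 0"
      using lim[OF has_derivative_p_of[OF x j nz l]] nz[OF l] y0
      by (intro tendsto_imp_eventually_ne) (auto simp: y_def)
  qed simp
  moreover have "\<forall>\<^sub>F s in nhds 0. vec n (z_of (y s)) \<notin> discriminant n k b"
  proof (rule eventually_notin_discriminant[OF _ zd])
    fix l assume l: "l < n"
    show "((\<lambda>s. vec n (z_of (y s)) $ l) \<longlongrightarrow> vec n (z_of x) $ l) (nhds 0)"
      using lim[OF has_derivative_z_of[OF x j nz l]] l y0 by (simp add: y_def)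
  qed
  ultimately have "\<forall>\<^sub>F s in nhds 0.
      fst (the_inv_into (Lam n k b a) (chart n M) (y s)) $ i = z_of (y s) i"
    by eventually_elim (use i y in \<open>simp add: the_inv_into_chart param_def\<close>)
  then have "deriv (\<lambda>s. fst (the_inv_into (Lam n k b a) (chart n M) (y s)) $ i) 0 =
      deriv (\<lambda>s. z_of (y s) i) 0"
    by (rule deriv_cong_ev) simp
  also have "\<dots> = X_der x i j"
    unfolding y_def by (rule DERIV_imp_deriv[OF has_derivative_z_of[OF x j nz i]])
  finally show ?thesis
    using x by (simp add: partial_def y_def x_def[symmetric])
qed

end

section \<open>Existence of the dual basis and the formula for the Jacobian\<close>

lemma obtain_dual_frame:
  assumes M: "M \<subseteq> {..<n}" "card M = k" and minor: "minor k b (sorted_list_of_set M) \<noteq> 0"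
    and a: "\<And>j. j < n \<Longrightarrow> a j \<noteq> 0"
  obtains R where "dual_frame n k b a M R"
proof -
  define s where "s = sorted_list_of_set M"
  define S where "S = mat k k (\<lambda>(l, m). b (s ! l) m)"
  have fin: "finite M" using M(1) finite_subset by blast
  have bij: "bij_betw (\<lambda>r. s ! r) {..<k} M"
    unfolding s_def using fin M by (intro bij_betw_nth) auto
  have S: "S \<in> carrier_mat k k" by (simp add: S_def)
  have "det S \<noteq> 0" using minor by (simp add: minor_def S_def s_def)
  from det_non_zero_imp_unit[OF S this, of "()"]
  obtain N where N: "N \<in> carrier_mat k k" "N * S = 1\<^sub>m k" "S * N = 1\<^sub>m k"
    unfolding Units_def ring_mat_def by auto
  define pos where "pos = the_inv_into {..<k} (\<lambda>r. s ! r)"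
  have pos: "pos (s ! r) = r" if "r < k" for r
    unfolding pos_def using bij that by (intro the_inv_into_f_f) (auto simp: bij_betw_def)
  have ent: "(\<Sum>r<k. N $$ (i, r) * b (s ! r) m) = of_bool (i = m)" if "i < k" "m < k" for i m
    using arg_cong[OF N(2), of "\<lambda>A. A $$ (i, m)"] N(1) S that
    by (simp add: scalar_prod_def S_def lessThan_atLeast0)
  have ent': "(\<Sum>r<k. b (s ! i) r * N $$ (r, m)) = of_bool (i = m)" if "i < k" "m < k" for i m
    using arg_cong[OF N(3), of "\<lambda>A. A $$ (i, m)"] N(1) S that
    by (simp add: scalar_prod_def S_def lessThan_atLeast0)
  have "dual_frame n k b a M (\<lambda>i j. N $$ (i, pos j))"
  proof
    fix i m assume im: "i < k" "m < k"
    have "(\<Sum>j\<in>M. N $$ (i, pos j) * b j m) = (\<Sum>r<k. N $$ (i, pos (s ! r)) * b (s ! r) m)"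
      by (rule sum.reindex_bij_betw[OF bij, symmetric])
    also have "\<dots> = (\<Sum>r<k. N $$ (i, r) * b (s ! r) m)"
      by (intro sum.cong) (auto simp: pos)
    finally show "(\<Sum>j\<in>M. N $$ (i, pos j) * b j m) = of_bool (i = m)" using ent im by simp
  next
    fix j l assume "j \<in> M" "l \<in> M"
    then obtain r r' where "r < k" "r' < k" "j = s ! r" "l = s ! r'"
      using bij by (auto simp: bij_betw_def)
    moreover from this have "s ! r = s ! r' \<longleftrightarrow> r = r'" using pos by metis
    ultimately show "(\<Sum>i<k. b j i * N $$ (i, pos l)) = of_bool (j = l)"
      by (simp add: pos ent')
  qed (use M a in auto)
  then show ?thesis by (rule that)
qed

theorem corollary3p9:
  fixes n k :: nat
    and b :: "nat \<Rightarrow> nat \<Rightarrow> complex"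
    and a :: "nat \<Rightarrow> complex"
    and M :: "nat set"
  assumes "0 < k" and "k < n"
    and "\<And>idx. length idx = k \<Longrightarrow> distinct idx \<Longrightarrow> set idx \<subseteq> {..<n} \<Longrightarrow> minor k b idx \<noteq> 0"
    and "\<And>j. j < n \<Longrightarrow> a j \<noteq> 0"
    and "(\<Sum>j<n. a j) \<noteq> 0"
    and "M \<subseteq> {..<n}" and "card M = k"
  shows "\<forall>(z, p) \<in> Lam n k b a.
    minor_sq k b M * Jac n k b a M (z, p) =
      (-1) ^ n * Hess_Lam n k b a (z, p) * (\<Prod>j<n. a j / (vec_index p j)\<^sup>2)"
proof (rule ballI, clarify)
  fix z p assume q: "(z, p) \<in> Lam n k b a"
  have fin: "finite M" using assms(6) finite_subset by blast
  have "minor k b (sorted_list_of_set M) \<noteq> 0"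
    using assms(6,7) fin by (intro assms(3)) auto
  then obtain R where "dual_frame n k b a M R"
    using obtain_dual_frame[OF assms(6,7), of b a] assms(4) by blast
  then interpret dual_frame n k b a M R .
  define x where "x = chart n M (z, p)"
  have pa: "vec n (p_of x) = p"
    using param_chart[OF q] by (auto simp: param_def x_def)
  have px: "p_of x i = p $ i" if "i < n" for i
    using that by (simp flip: pa)
  have nz: "p $ i \<noteq> 0" if "i < n" for i
    using q that unfolding in_Lam_iff by auto
  define c where "c i = (p $ i)\<^sup>2 / a i" for i
  have c: "c i \<noteq> 0" if "i < n" for i using nz a that by (simp add: c_def)
  have X: "X_der x i j = - P_der i j / c i - (\<Sum>m<k. b i m * T_der x m j)" if "i < n" for i j
    using that by (simp add: X_der_def c_def px)
  have Jac: "Jac n k b a M (z, p) = det (mat n n (\<lambda>(i, j). X_der x i j))"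
    unfolding Jac_def x_def
    by (intro arg_cong[of _ _ det] eq_matI) (auto simp: partial_inverse_chart[OF q])
  have XM: "X_der x i j = of_bool (i = j)" if "i \<in> M" "j < n" for i j
  proof -
    have i: "i < n" using that M by auto
    have xc: "x \<in> carrier_vec n" by (simp add: x_def chart_def)
    have "((\<lambda>s. z_of (x + s \<cdot>\<^sub>v unit_vec n j) i) has_field_derivative X_der x i j) (at 0)"
      by (rule has_derivative_z_of[OF xc \<open>j < n\<close> _ i]) (simp add: px nz)
    moreover have "((\<lambda>s. z_of (x + s \<cdot>\<^sub>v unit_vec n j) i) has_field_derivative of_bool (i = j)) (at 0)"
      unfolding z_of_M[OF that(1)] using xc i that(2)
      by (auto intro!: derivative_eq_intros)
    ultimately show ?thesis by (rule DERIV_unique)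
  qed
  have "minor_sq k b M * det (mat n n (\<lambda>(i, j). X_der x i j)) * (\<Prod>i<n. c i) =
    (-1) ^ (n + k) * det (mat k k (\<lambda>(i, j). \<Sum>l<n. c l * b l i * b l j))"
  proof (rule det_implicit_derivative[where P = P_der and T = "T_der x", OF assms(6,7) c X _ XM])
    show "(\<Sum>i<n. b i m * P_der i j) = 0" if "m < k" for m j
      using that by (simp add: P_der_def p_of_kernel)
    show "P_der i j = of_bool (i = j)" if "i < n" "i \<notin> M" "j < n" for i j
      using that by (simp add: P_der_def p_of_def)
  qed
  also have "\<dots> = (-1) ^ n * Hess_Lam n k b a (z, p)"
    unfolding Hess_Lam_eq[OF q] by (simp add: c_def power_add)
  finally have "minor_sq k b M * Jac n k b a M (z, p) * (\<Prod>i<n. c i) =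
    (-1) ^ n * Hess_Lam n k b a (z, p)" by (simp add: Jac)
  moreover have "(\<Prod>i<n. c i) * (\<Prod>j<n. a j / (p $ j)\<^sup>2) = 1"
    unfolding prod.distrib[symmetric] using nz a by (intro prod.neutral) (auto simp: c_def)
  ultimately show "minor_sq k b M * Jac n k b a M (z, p) =
      (-1) ^ n * Hess_Lam n k b a (z, p) * (\<Prod>j<n. a j / (p $ j)\<^sup>2)"
    by (metis mult.assoc mult.right_neutral)
qed

end
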